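(* Let $t\ge 2$ and let $T_t$ be a tree on $t$ vertices. Then, for every positive integer $n$, $$\operatorname{ex}(n,K_{t-1},T_t)=\left\lfloor\frac{n}{t-1}\right\rfloor .$$ Moreover, the extremal graphs (the $n$-vertex $T_t$-free graphs with exactly $\operatorname{ex}(n,K_{t-1},T_t)$ copies of $K_{t-1}$) are exactly the graphs of the form $$\left\lfloor\frac{n}{t-1}\right\rfloor K_{t-1}\,\dot\cup\, H,$$ where $H$ is any graph on $n \bmod (t-1)$ vertices.
   Context: All graphs are finite, simple and undirected. $K_m$ is the complete graph on $m$ vertices ($K_0$ is the empty graph with no vertices). A graph $G$ is $F$-free if it contains no (not necessarily induced) subgraph isomorphic to $F$. For graphs $H,F$, $\operatorname{ex}(n,H,F)$ is the maximum number of copies of $H$ (as subgraphs) in an $n$-vertex $F$-free graph. $G_1\dot\cup G_2$ is the vertex-disjoint union, with no edges between the two graphs, and $mG$ is the disjoint union of $m$ copies of $G$. Extremal graphs are described up to isomorphism. *)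

theory Defs
  imports "Graph_Theory.Graph_Theory"
begin

text \<open>
  A finite simple graph is a \<open>pair_graph\<close> of the library: a finite, loop-free pair digraph whose
  arc relation is symmetric, the undirected edge \<open>uv\<close> being the two arcs \<open>(u, v)\<close> and \<open>(v, u)\<close>.
\<close>

abbreviation graph_iso :: "'a pair_pre_digraph \<Rightarrow> 'b pair_pre_digraph \<Rightarrow> bool" where
  "graph_iso G H \<equiv> digraph_iso (with_proj G) (with_proj H)"

text \<open>
  The library predicate \<open>tree\<close> is not usable here: it forbids every directed cycle, and in a
  symmetric digraph each edge already gives the directed cycle \<open>u, v, u\<close>. The cycles of length
  at least 3 are those of the undirected graph.
\<close>

definition undirected_tree :: "'a pair_pre_digraph \<Rightarrow> bool" where
  "undirected_tree T \<longleftrightarrow> pair_graph T \<and> connected (with_proj T) \<and>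
     \<not> (\<exists>p. pre_digraph.cycle (with_proj T) p \<and> 3 \<le> length p)"

definition complete_graph :: "nat \<Rightarrow> nat pair_pre_digraph" where
  "complete_graph m =
     \<lparr>pverts = {..<m}, parcs = {(u, v). u < m \<and> v < m \<and> u \<noteq> v}\<rparr>"

lemma complete_digraph_complete_graph: "K\<^bsub>m\<^esub> (with_proj (complete_graph m))"
  by (auto simp: complete_digraph_pair_def complete_graph_def)

definition disjoint_union ::
  "'a pair_pre_digraph \<Rightarrow> 'b pair_pre_digraph \<Rightarrow> ('a + 'b) pair_pre_digraph" where
  "disjoint_union G H =
     \<lparr>pverts = Inl ` pverts G \<union> Inr ` pverts H,
      parcs = {(Inl u, Inl v) | u v. (u, v) \<in> parcs G} \<union> {(Inr u, Inr v) | u v. (u, v) \<in> parcs H}\<rparr>"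

definition disjoint_copies :: "nat \<Rightarrow> 'a pair_pre_digraph \<Rightarrow> (nat \<times> 'a) pair_pre_digraph" where
  "disjoint_copies m G =
     \<lparr>pverts = {..<m} \<times> pverts G,
      parcs = {((i, u), (i, v)) | i u v. i < m \<and> (u, v) \<in> parcs G}\<rparr>"

text \<open>A copy of \<open>H\<close> in \<open>G\<close> is a (not necessarily induced) subgraph of \<open>G\<close> isomorphic to \<open>H\<close>.\<close>

definition copies :: "'a pair_pre_digraph \<Rightarrow> 'b pair_pre_digraph \<Rightarrow> 'b pair_pre_digraph set" where
  "copies H G = {S. subgraph (with_proj S) (with_proj G) \<and> graph_iso H S}"

definition free_of :: "'a pair_pre_digraph \<Rightarrow> 'b pair_pre_digraph \<Rightarrow> bool" where
  "free_of F G \<longleftrightarrow> copies F G = {}"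

text \<open>
  Every finite graph is isomorphic to one with vertices in \<^typ>\<open>nat\<close>, so the maximum may be
  taken over those. \<open>Max\<close> is unspecified if there is no \<open>F\<close>-free graph on \<open>n\<close> vertices.
\<close>

definition ex :: "nat \<Rightarrow> 'a pair_pre_digraph \<Rightarrow> 'b pair_pre_digraph \<Rightarrow> nat" where
  "ex n H F = Max {card (copies H G) | G :: nat pair_pre_digraph.
     pair_graph G \<and> card (pverts G) = n \<and> free_of F G}"

definition extremal ::
  "nat \<Rightarrow> 'a pair_pre_digraph \<Rightarrow> 'b pair_pre_digraph \<Rightarrow> 'c pair_pre_digraph \<Rightarrow> bool" where
  "extremal n H F G \<longleftrightarrow>
     pair_graph G \<and> card (pverts G) = n \<and> free_of F G \<and> card (copies H G) = ex n H F"

end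

theory Submission
  imports Defs
begin

text \<open>
  Write \<open>k = t - 1\<close>. In a graph without \<open>T\<close>, no edge leaves a \<open>k\<close>-clique \<open>X\<close>: given an edge from
  \<open>u \<in> X\<close> to \<open>v \<notin> X\<close>, a leaf of \<open>T\<close> could be mapped to \<open>v\<close>, its neighbour to \<open>u\<close> and the remaining
  \<open>k - 1\<close> vertices of \<open>T\<close> anywhere into \<open>X - {u}\<close>, which would be a copy of \<open>T\<close>
  (\<open>tree_free_cliques_closed\<close>). So every \<open>k\<close>-clique is a connected component. Components are
  disjoint, hence there are at most \<open>n div k\<close> of them, and when there are exactly that many, they
  leave \<open>n mod k\<close> vertices that have no edge to them, which is the claimed structure
  (\<open>clique_union_if_component_cliques\<close>).

  Conversely, suppose that \<open>n div k\<close> cliques of size \<open>k\<close> are components. Then the vertices of the graph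
  are partitioned into sets with at most \<open>k\<close> elements and no edges between them. The connected graph
  \<open>T\<close> on \<open>k + 1\<close> vertices fits into none of them, so the graph is \<open>T\<close>-free
  (\<open>tree_free_if_component_cliques\<close>).

  Both directions therefore go through one number, the number of \<open>k\<close>-cliques that are components:
  a graph on \<open>n\<close> vertices is extremal iff this number is \<open>n div k\<close>, and it is \<open>n div k\<close> iff the graph
  has the stated form.
\<close>

section \<open>Isomorphism and copies through vertex maps\<close>

lemma pair_graph_iff:
  "pair_graph G \<longleftrightarrow> finite (pverts G) \<and> parcs G \<subseteq> pverts G \<times> pverts G \<and> sym (parcs G) \<and>
     (\<forall>u. (u, u) \<notin> parcs G)"
proof
  assume "pair_graph G"
  then interpret pair_graph G .
  show "finite (pverts G) \<and> parcs G \<subseteq> pverts G \<times> pverts G \<and> sym (parcs G) \<and>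
     (\<forall>u. (u, u) \<notin> parcs G)"
    using pair_finite_verts arcs_symmetric no_loops'
    by (auto intro: in_arcsD1 in_arcsD2 symI)
next
  assume G: "finite (pverts G) \<and> parcs G \<subseteq> pverts G \<times> pverts G \<and> sym (parcs G) \<and>
     (\<forall>u. (u, u) \<notin> parcs G)"
  then have "finite (parcs G)"
    by (meson finite_SigmaI finite_subset)
  with G show "pair_graph G"
    by unfold_locales (auto simp: symmetric_def)
qed

text \<open>
  A library isomorphism also carries an arc map and new head and tail functions. Between pair
  digraphs all three are determined by the vertex map, as heads and tails are the projections.
\<close>

lemma graph_iso_iff:
  "graph_iso G H \<longleftrightarrow> pair_wf_digraph G \<and>
     (\<exists>f. inj_on f (pverts G) \<and> pverts H = f ` pverts G \<and> parcs H = map_prod f f ` parcs G)"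
proof
  assume "graph_iso G H"
  then obtain h where h: "pre_digraph.digraph_isomorphism (with_proj G) h"
    and H: "with_proj H = app_iso h (with_proj G)"
    by (auto simp: digraph_iso_def)
  \<comment> \<open>Comparing the fields forces the tail and head maps of \<open>h\<close> to be the projections.\<close>
  have "verts (with_proj H) = verts (app_iso h (with_proj G))"
    "arcs (with_proj H) = arcs (app_iso h (with_proj G))"
    "tail (with_proj H) = tail (app_iso h (with_proj G))"
    "head (with_proj H) = head (app_iso h (with_proj G))"
    using H by simp_all
  then have V: "pverts H = iso_verts h ` pverts G" and A: "parcs H = iso_arcs h ` parcs G"
    and ends: "iso_tail h = fst" "iso_head h = snd"
    by simp_all
  have "iso_arcs h a = map_prod (iso_verts h) (iso_verts h) a" if "a \<in> parcs G" for a
    using h ends that by (auto simp: pre_digraph.digraph_isomorphism_def prod_eq_iff)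
  with A have "parcs H = map_prod (iso_verts h) (iso_verts h) ` parcs G"
    by (simp cong: image_cong)
  with V h show "pair_wf_digraph G \<and>
     (\<exists>f. inj_on f (pverts G) \<and> pverts H = f ` pverts G \<and> parcs H = map_prod f f ` parcs G)"
    by (auto simp: pre_digraph.digraph_isomorphism_def wf_digraph_wp_iff)
next
  assume "pair_wf_digraph G \<and>
     (\<exists>f. inj_on f (pverts G) \<and> pverts H = f ` pverts G \<and> parcs H = map_prod f f ` parcs G)"
  then obtain f where wf: "pair_wf_digraph G" and f: "inj_on f (pverts G)"
    and H: "pverts H = f ` pverts G" "parcs H = map_prod f f ` parcs G"
    by blast
  interpret pair_wf_digraph G by fact
  define h where "h = \<lparr>iso_verts = f, iso_arcs = map_prod f f, iso_head = snd, iso_tail = fst\<rparr>"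
  have "inj_on (map_prod f f) (parcs G)"
    by (rule inj_on_subset[OF map_prod_inj_on[OF f f]]) (auto intro: in_arcsD1 in_arcsD2)
  then have "pre_digraph.digraph_isomorphism (with_proj G) h"
    using wf f by (auto simp: pre_digraph.digraph_isomorphism_def h_def wf_digraph_wp_iff)
  moreover have "with_proj H = app_iso h (with_proj G)"
    using H by (simp add: app_iso_def h_def with_proj_def)
  ultimately show "graph_iso G H"
    by (auto simp: digraph_iso_def)
qed

lemma pair_graph_wf: "pair_graph G \<Longrightarrow> pair_wf_digraph G"
  by (simp add: pair_graph_def pair_digraph_def pair_fin_digraph_def)

lemma graph_iso_sym: "graph_iso G H \<Longrightarrow> graph_iso H G"
  by (meson digraph_iso_swap graph_iso_iff wf_digraph_wp_iff)

lemma pair_graph_iso: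
  assumes "pair_graph G" "graph_iso G H"
  shows "pair_graph H" "card (pverts H) = card (pverts G)"
proof -
  obtain f where f: "inj_on f (pverts G)"
    and H: "pverts H = f ` pverts G" "parcs H = map_prod f f ` parcs G"
    using assms by (auto simp: graph_iso_iff)
  show "card (pverts H) = card (pverts G)"
    using f H by (simp add: card_image)
  show "pair_graph H"
    unfolding pair_graph_iff
  proof (intro conjI allI notI)
    show "finite (pverts H)" "parcs H \<subseteq> pverts H \<times> pverts H"
      using assms(1) H by (auto simp: pair_graph_iff)
    show "sym (parcs H)"
      using assms(1) H by (force simp: pair_graph_iff sym_def)
    fix u assume "(u, u) \<in> parcs H"
    then obtain a b where "(a, b) \<in> parcs G" "f a = f b"
      using H by auto
    with f assms(1) show False
      by (metis inj_onD mem_Sigma_iff pair_graph_iff subsetD)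
  qed
qed

definition graph_embedding :: "('a \<Rightarrow> 'b) \<Rightarrow> 'a pair_pre_digraph \<Rightarrow> 'b pair_pre_digraph \<Rightarrow> bool" where
  "graph_embedding f F G \<longleftrightarrow> inj_on f (pverts F) \<and> f ` pverts F \<subseteq> pverts G \<and>
     (\<forall>u v. (u, v) \<in> parcs F \<longrightarrow> (f u, f v) \<in> parcs G)"

text \<open>
  The image of an embedding is a copy, and the isomorphism onto a copy is an embedding.
\<close>

lemma free_of_iff:
  assumes "pair_graph F" "pair_graph G"
  shows "free_of F G \<longleftrightarrow> (\<nexists>f. graph_embedding f F G)"
proof -
  have "graph_embedding f F G" if "inj_on f (pverts F)" "pverts S = f ` pverts F"
    "parcs S = map_prod f f ` parcs F" "subgraph (with_proj S) (with_proj G)" for S f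
    using that by (force simp: graph_embedding_def subgraph_def)
  moreover have "\<lparr>pverts = f ` pverts F, parcs = map_prod f f ` parcs F\<rparr> \<in> copies F G"
    (is "?S \<in> _") if f: "graph_embedding f F G" for f
  proof -
    have iso: "graph_iso F ?S"
      using assms(1) f by (auto simp: graph_iso_iff graph_embedding_def pair_graph_wf)
    then have "pair_wf_digraph ?S"
      using assms(1) pair_graph_iso pair_graph_wf by blast
    then show ?thesis
      using f iso assms(2)
      by (auto simp: copies_def subgraph_def compatible_def graph_embedding_def
          wf_digraph_wp_iff pair_graph_wf)
  qed
  moreover have "\<exists>f. inj_on f (pverts F) \<and> pverts S = f ` pverts F \<and>
    parcs S = map_prod f f ` parcs F" "subgraph (with_proj S) (with_proj G)" if "S \<in> copies F G" for S
    using that by (auto simp: copies_def graph_iso_iff)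
  ultimately show ?thesis
    unfolding free_of_def by (metis all_not_in_conv)
qed

section \<open>Cliques\<close>

definition cliques :: "nat \<Rightarrow> 'a pair_pre_digraph \<Rightarrow> 'a set set" where
  "cliques k G = {X. X \<subseteq> pverts G \<and> card X = k \<and> (\<forall>u\<in>X. \<forall>v\<in>X. u \<noteq> v \<longrightarrow> (u, v) \<in> parcs G)}"

lemma graph_iso_complete_graph_iff:
  "graph_iso (complete_graph k) S \<longleftrightarrow>
     finite (pverts S) \<and> card (pverts S) = k \<and>
     parcs S = {(u, v). u \<in> pverts S \<and> v \<in> pverts S \<and> u \<noteq> v}"
proof -
  have wf: "pair_wf_digraph (complete_graph k)"
    by (rule pair_graph_wf) (auto simp: pair_graph_iff complete_graph_def sym_def)
  have arcs: "map_prod f f ` parcs (complete_graph k) =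
      {(u, v). u \<in> f ` {..<k} \<and> v \<in> f ` {..<k} \<and> u \<noteq> v}" if "inj_on f {..<k}" for f :: "nat \<Rightarrow> 'a"
    using that by (force simp: complete_graph_def inj_on_def)
  show ?thesis
  proof
    assume "graph_iso (complete_graph k) S"
    then obtain f where f: "inj_on f {..<k}" "pverts S = f ` {..<k}"
      "parcs S = map_prod f f ` parcs (complete_graph k)"
      by (auto simp: graph_iso_iff complete_graph_def)
    then show "finite (pverts S) \<and> card (pverts S) = k \<and>
      parcs S = {(u, v). u \<in> pverts S \<and> v \<in> pverts S \<and> u \<noteq> v}"
      using arcs[OF f(1)] by (simp add: card_image)
  next
    assume S: "finite (pverts S) \<and> card (pverts S) = k \<and>
      parcs S = {(u, v). u \<in> pverts S \<and> v \<in> pverts S \<and> u \<noteq> v}"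
    then obtain f where "bij_betw f {..<k} (pverts S)"
      by (metis bij_betw_from_nat_into_finite)
    then have "inj_on f {..<k}" "pverts S = f ` {..<k}"
      by (auto simp: bij_betw_def)
    moreover from this have "parcs S = map_prod f f ` parcs (complete_graph k)"
      using S arcs[of f] by simp
    moreover have "pverts (complete_graph k) = {..<k}"
      by (simp add: complete_graph_def)
    ultimately show "graph_iso (complete_graph k) S"
      using wf unfolding graph_iso_iff by auto
  qed
qed

text \<open>A complete subgraph is determined by its vertex set, and every clique carries one.\<close>

lemma card_copies_complete_graph:
  assumes "pair_graph G"
  shows "card (copies (complete_graph k) G) = card (cliques k G)"
proof (rule bij_betw_same_card)
  let ?K = "\<lambda>X. \<lparr>pverts = X, parcs = {(u, v). u \<in> X \<and> v \<in> X \<and> u \<noteq> v}\<rparr>"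
  have "finite (pverts G)"
    using assms by (simp add: pair_graph_iff)
  moreover have "pair_wf_digraph (?K X)" for X :: "'a set"
    by (auto simp: pair_wf_digraph_def)
  ultimately have K: "?K X \<in> copies (complete_graph k) G" if "X \<in> cliques k G" for X
    using that assms finite_subset[of X "pverts G"]
    by (auto simp: copies_def graph_iso_complete_graph_iff cliques_def subgraph_def compatible_def
        wf_digraph_wp_iff pair_graph_wf)
  have S: "pverts S \<in> cliques k G \<and> ?K (pverts S) = S" if "S \<in> copies (complete_graph k) G" for S
  proof -
    have V: "pverts S \<subseteq> pverts G" "parcs S \<subseteq> parcs G" "card (pverts S) = k"
      and A: "parcs S = {(u, v). u \<in> pverts S \<and> v \<in> pverts S \<and> u \<noteq> v}"
      using that unfolding copies_def graph_iso_complete_graph_iff subgraph_def with_proj_simps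
      by blast+
    have "?K (pverts S) = S"
      using A by (intro pair_pre_digraph.equality) simp_all
    moreover have "(u, v) \<in> parcs G" if "u \<in> pverts S" "v \<in> pverts S" "u \<noteq> v" for u v
      using V(2) that unfolding A by blast
    ultimately show ?thesis
      using V by (simp add: cliques_def)
  qed
  show "bij_betw pverts (copies (complete_graph k) G) (cliques k G)"
    using K S by (intro bij_betw_byWitness[where f' = ?K]) (simp_all add: image_subset_iff)
qed

section \<open>Leaves of trees\<close>

text \<open>
  The first vertex of a longest path is a leaf. A further neighbour outside the path would prolong
  the path, and one on the path would close a cycle of length at least 3.
\<close>

lemma undirected_tree_leaf:
  assumes T: "undirected_tree T" and "2 \<le> card (pverts T)"
  obtains l p where "(l, p) \<in> parcs T" "\<And>x. (l, x) \<in> parcs T \<Longrightarrow> x = p"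
proof -
  interpret pair_graph T
    using T by (simp add: undirected_tree_def)
  have acyclic: "\<not> (cycle p \<and> 3 \<le> length p)" for p
    using T by (auto simp: undirected_tree_def)
  have "strongly_connected (with_proj T)"
    using T symmetric_connected_imp_strongly_connected pair_sym_arcs
    by (auto simp: undirected_tree_def)
  obtain a b where ab: "a \<in> pverts T" "b \<in> pverts T" "a \<noteq> b"
    using assms(2)
    by (metis card_le_Suc0_iff_eq not_less_eq_eq numeral_2_eq_2 pair_finite_verts)
  then have "a \<rightarrow>\<^sup>*\<^bsub>with_proj T\<^esub> b"
    using \<open>strongly_connected (with_proj T)\<close> by (auto simp: strongly_connected_def)
  then obtain q where q: "apath a q b"
    using reachable_apath by blast
  then have "q \<noteq> []"
    using ab by (auto simp: apath_Nil_iff)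
  define P where "P p \<longleftrightarrow> (\<exists>u v. apath u p v)" for p
  have "P q"
    using q by (auto simp: P_def)
  have "length p < card (pverts T)" if "P p" for p
    using that length_apath_less by (auto simp: P_def)
  then obtain p where p: "P p" and longest: "\<And>p'. P p' \<Longrightarrow> length p' \<le> length p"
    using \<open>P q\<close> ex_has_greatest_nat[of P q length "card (pverts T)"] by (metis less_imp_le)
  then obtain u v where uv: "apath u p v"
    by (auto simp: P_def)
  have "p \<noteq> []"
    using longest[OF \<open>P q\<close>] \<open>q \<noteq> []\<close> by auto
  then obtain w p' where p': "p = (u, w) # p'" "(u, w) \<in> parcs T"
    using uv by (cases p) (auto simp: apath_Cons_iff)
  have "x = w" if x: "(u, x) \<in> parcs T" for x
  proof (rule ccontr)
    assume "x \<noteq> w"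
    have xu: "(x, u) \<in> parcs T" "x \<noteq> u"
      using x arcs_symmetric no_loops' by auto
    show False
    proof (cases "x \<in> set (awalk_verts u p)")
      case False
      then have "apath x ((x, u) # p) v"
        using xu uv by (simp add: apath_Cons_iff)
      then show False
        using longest[of "(x, u) # p"] by (auto simp: P_def)
    next
      case True
      then obtain q r where qr: "p = q @ r" "awalk u q x"
        using awalk_decomp[of u p v x] uv by (auto simp: apath_def)
      then have "apath u q x"
        using uv apath_append_iff[of u q r v] by (simp add: apath_def)
      have "q \<noteq> []" "q \<noteq> [(u, w)]"
        using qr(2) xu \<open>x \<noteq> w\<close> by (auto simp: awalk_simps)
      then have "3 \<le> length ((x, u) # q)"
        using qr(1) p' by (cases q rule: remdups_adj.cases) auto
      moreover have "cycle ((x, u) # q)"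
        using xu \<open>apath u q x\<close>
        by (auto simp: cycle_def apath_def awalk_Cons_iff intro!: exI[of _ x])
      ultimately show False
        using acyclic by blast
    qed
  qed
  with p' show thesis
    using that by blast
qed

section \<open>Cliques that are components\<close>

definition closed_under_arcs :: "'a pair_pre_digraph \<Rightarrow> 'a set \<Rightarrow> bool" where
  "closed_under_arcs G C \<longleftrightarrow> (\<forall>u v. (u, v) \<in> parcs G \<longrightarrow> u \<in> C \<longrightarrow> v \<in> C)"

text \<open>
  Arcs of \<open>T\<close> are mapped to arcs of \<open>G\<close>, which do not leave \<open>C\<close>, so membership in \<open>C\<close> spreads from
  \<open>f x\<close> to the images of all vertices that are reachable from \<open>x\<close>.
\<close>

lemma connected_embedding_in_closed:
  assumes "pair_graph T" "connected (with_proj T)" "graph_embedding f T G"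
    and C: "closed_under_arcs G C" and "x \<in> pverts T" "f x \<in> C"
  shows "f ` pverts T \<subseteq> C"
proof
  interpret pair_graph T by fact
  fix w assume "w \<in> f ` pverts T"
  then obtain y where y: "y \<in> pverts T" "w = f y"
    by blast
  have "strongly_connected (with_proj T)"
    using assms(2) symmetric_connected_imp_strongly_connected pair_sym_arcs by blast
  then have "x \<rightarrow>\<^sup>*\<^bsub>with_proj T\<^esub> y"
    using assms(5) y by (auto simp: strongly_connected_def)
  then have "(x, y) \<in> (parcs T)\<^sup>*"
    unfolding reachable_def by (metis rtrancl_on_rtranclI with_proj_simps(3))
  then have "f y \<in> C"
  proof induction
    case base
    show ?case by fact
  next
    case (step y z)
    then show ?case
      using assms(3) C unfolding graph_embedding_def closed_under_arcs_def by blast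
  qed
  with y show "w \<in> C" by simp
qed

definition component_cliques :: "nat \<Rightarrow> 'a pair_pre_digraph \<Rightarrow> 'a set set" where
  "component_cliques k G = {X \<in> cliques k G. closed_under_arcs G X}"

lemma finite_component_cliques: "pair_graph G \<Longrightarrow> finite (component_cliques k G)"
  by (rule finite_subset[of _ "Pow (pverts G)"])
    (auto simp: component_cliques_def cliques_def pair_graph_iff)

text \<open>
  If two such cliques share \<open>x\<close>, every vertex of one is \<open>x\<close> or a neighbour of \<open>x\<close>, hence belongs to
  the other, which no arc leaves.
\<close>

lemma component_cliques_disjoint:
  assumes "X \<in> component_cliques k G" "Y \<in> component_cliques k G" "X \<noteq> Y"
  shows "X \<inter> Y = {}"
proof (rule ccontr)
  assume "X \<inter> Y \<noteq> {}"
  then obtain x where "x \<in> X" "x \<in> Y" by blast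
  have "Y' \<subseteq> X'" if "X' \<in> component_cliques k G" "Y' \<in> component_cliques k G" "x \<in> X'" "x \<in> Y'"
    for X' Y'
  proof
    fix y assume "y \<in> Y'"
    then have "y = x \<or> (x, y) \<in> parcs G"
      using that by (auto simp: component_cliques_def cliques_def)
    then show "y \<in> X'"
      using that by (auto simp: component_cliques_def closed_under_arcs_def)
  qed
  then show False
    using assms \<open>x \<in> X\<close> \<open>x \<in> Y\<close> by blast
qed

lemma card_Union_component_cliques:
  assumes "pair_graph G"
  shows "card (\<Union>(component_cliques k G)) = k * card (component_cliques k G)"
proof -
  have "finite X" "card X = k" if "X \<in> component_cliques k G" for X
    using that assms finite_subset[of X "pverts G"]
    by (auto simp: component_cliques_def cliques_def pair_graph_iff)
  moreover have "pairwise disjnt (component_cliques k G)"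
    unfolding pairwise_def disjnt_def using component_cliques_disjoint by blast
  ultimately have "card (\<Union>(component_cliques k G)) = (\<Sum>X\<in>component_cliques k G. k)"
    by (simp add: card_Union_disjoint)
  then show ?thesis by simp
qed

lemma Union_component_cliques_subset: "\<Union>(component_cliques k G) \<subseteq> pverts G"
  by (auto simp: component_cliques_def cliques_def)

lemma card_component_cliques_le:
  assumes "pair_graph G" "0 < k"
  shows "card (component_cliques k G) \<le> card (pverts G) div k"
proof -
  have "k * card (component_cliques k G) \<le> card (pverts G)"
    using card_mono[OF _ Union_component_cliques_subset] assms(1) card_Union_component_cliques
    by (metis pair_graph_iff)
  then show ?thesis
    using assms(2) by (simp add: less_eq_div_iff_mult_less_eq mult.commute)
qed

lemma closed_remainder:
  assumes "pair_graph G"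
  shows "closed_under_arcs G (pverts G - \<Union>(component_cliques k G))"
  unfolding closed_under_arcs_def
proof (intro allI impI)
  fix u v assume uv: "(u, v) \<in> parcs G" and u: "u \<in> pverts G - \<Union>(component_cliques k G)"
  have "(v, u) \<in> parcs G" "v \<in> pverts G"
    using uv assms by (auto simp: pair_graph_iff dest: symD)
  with u show "v \<in> pverts G - \<Union>(component_cliques k G)"
    by (auto simp: component_cliques_def closed_under_arcs_def)
qed

lemma card_remainder:
  assumes "pair_graph G" "card (component_cliques k G) = card (pverts G) div k"
  shows "card (pverts G - \<Union>(component_cliques k G)) = card (pverts G) mod k"
proof -
  have "finite (\<Union>(component_cliques k G))"
    using assms(1) Union_component_cliques_subset by (metis finite_subset pair_graph_iff)
  then show ?thesis
    using assms card_Union_component_cliques[OF assms(1), of k]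
      Union_component_cliques_subset[of k G]
    by (simp add: card_Diff_subset minus_mult_div_eq_mod)
qed

text \<open>
  An arc from \<open>u\<close> in a \<open>k\<close>-clique to \<open>v\<close> outside would give room for the one vertex by which the tree
  exceeds the clique: a leaf goes to \<open>v\<close>, as its only neighbour can be placed at \<open>u\<close>.
\<close>

lemma tree_free_cliques_closed:
  assumes T: "undirected_tree T" "card (pverts T) = Suc k" "0 < k"
    and G: "pair_graph G" "free_of T G"
  shows "component_cliques k G = cliques k G"
proof -
  have "closed_under_arcs G X" if X: "X \<in> cliques k G" for X
  proof (rule ccontr)
    assume "\<not> closed_under_arcs G X"
    then obtain u v where uv: "(u, v) \<in> parcs G" "u \<in> X" "v \<notin> X"
      by (auto simp: closed_under_arcs_def)
    have T': "pair_graph T"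
      using T by (simp add: undirected_tree_def)
    obtain l p where lp: "(l, p) \<in> parcs T" and leaf: "\<And>x. (l, x) \<in> parcs T \<Longrightarrow> x = p"
      using undirected_tree_leaf[OF T(1)] T by auto
    have Tarcs: "parcs T \<subseteq> pverts T \<times> pverts T" "sym (parcs T)" "\<And>x. (x, x) \<notin> parcs T"
      "finite (pverts T)"
      using T' by (auto simp: pair_graph_iff)
    then have "l \<in> pverts T" "p \<in> pverts T" "l \<noteq> p"
      using lp by auto
    \<comment> \<open>\<open>B\<close> and \<open>X - {u}\<close> both have \<open>k - 1\<close> elements; adjacency inside \<open>X\<close> comes for free, so any
      bijection between them serves.\<close>
    define B where "B = pverts T - {l, p}"
    have "card B = card (X - {u})" "finite B" "finite (X - {u})"
      using \<open>l \<in> pverts T\<close> \<open>p \<in> pverts T\<close> \<open>l \<noteq> p\<close> T X uv Tarcs(4) G(1)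
        finite_subset[of X "pverts G"]
      by (auto simp: B_def cliques_def card_Diff_subset pair_graph_iff)
    then obtain g where g: "bij_betw g B (X - {u})"
      using finite_same_card_bij by blast
    define f where "f = g(p := u, l := v)"
    have fB: "f x = g x" "g x \<in> X - {u}" if "x \<in> B" for x
      using that g by (auto simp: f_def B_def bij_betw_def)
    have fp: "f p = u" "f l = v"
      using \<open>l \<noteq> p\<close> by (auto simp: f_def)
    have V: "pverts T = insert l (insert p B)"
      using \<open>l \<in> pverts T\<close> \<open>p \<in> pverts T\<close> by (auto simp: B_def)
    have "inj_on f B"
      using g fB by (auto simp: inj_on_def bij_betw_def)
    moreover have "f p \<notin> f ` B"
      using fB fp by (metis Diff_iff imageE insertI1)
    ultimately have "inj_on f (insert p B)"
      by (auto simp: inj_on_insert)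
    moreover have fX: "f x \<in> X" if "x \<in> insert p B" for x
      using that fB fp uv by auto
    moreover from this have "f l \<notin> f ` insert p B"
      using uv fp by auto
    ultimately have inj: "inj_on f (pverts T)"
      unfolding V inj_on_insert[of f l] by blast
    moreover have "f ` pverts T \<subseteq> pverts G"
      using fX fp uv X G(1) unfolding V by (auto simp: cliques_def pair_graph_iff)
    moreover have "(f x, f y) \<in> parcs G" if xy: "(x, y) \<in> parcs T" for x y
    proof -
      have "x \<in> pverts T" "y \<in> pverts T" "x \<noteq> y"
        using xy Tarcs by auto
      consider "x = l" | "y = l" | "x \<in> insert p B" "y \<in> insert p B"
        using \<open>x \<in> pverts T\<close> \<open>y \<in> pverts T\<close> V by auto
      then show ?thesis
      proof cases
        case 1
        then show ?thesis using leaf xy fp uv G(1) by (auto simp: pair_graph_iff dest: symD)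
      next
        case 2
        then have "x = p" using leaf xy Tarcs(2) by (auto dest: symD)
        then show ?thesis using 2 fp uv by simp
      next
        case 3
        moreover have "f x \<noteq> f y"
          using inj \<open>x \<noteq> y\<close> \<open>x \<in> pverts T\<close> \<open>y \<in> pverts T\<close> by (meson inj_onD)
        ultimately have "f x \<in> X" "f y \<in> X" "f x \<noteq> f y"
          using fX by blast+
        then show ?thesis using X by (auto simp: cliques_def)
      qed
    qed
    ultimately have "graph_embedding f T G"
      by (auto simp: graph_embedding_def)
    then show False
      using G T' by (auto simp: free_of_iff)
  qed
  then show ?thesis
    by (auto simp: component_cliques_def)
qed

text \<open>
  The component cliques and the set of the remaining vertices each have at most \<open>k\<close> elements and no
  arc leaves them, so a connected graph on \<open>k + 1\<close> vertices cannot be embedded.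
\<close>

lemma tree_free_if_component_cliques:
  assumes T: "undirected_tree T" "card (pverts T) = Suc k" "0 < k"
    and G: "pair_graph G" "card (component_cliques k G) = card (pverts G) div k"
  shows "free_of T G"
proof (rule ccontr)
  have T': "pair_graph T" "connected (with_proj T)"
    using T by (auto simp: undirected_tree_def)
  assume "\<not> free_of T G"
  then obtain f where f: "graph_embedding f T G"
    using G T' by (auto simp: free_of_iff)
  have "pverts T \<noteq> {}"
    using T by auto
  then obtain x where x: "x \<in> pverts T" by blast
  define R where "R = pverts G - \<Union>(component_cliques k G)"
  have "card R < k"
    using card_remainder[OF G] T(3) by (simp add: R_def)
  have "f x \<in> pverts G"
    using f x by (auto simp: graph_embedding_def)
  then obtain C where C: "f x \<in> C" "C \<in> insert R (component_cliques k G)"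
    by (auto simp: R_def)
  have "closed_under_arcs G C" "card C \<le> k" "C \<subseteq> pverts G"
    using C closed_remainder[OF G(1)] \<open>card R < k\<close>
    by (auto simp: component_cliques_def cliques_def R_def)
  then have "f ` pverts T \<subseteq> C" "finite C"
    using connected_embedding_in_closed[OF T' f] x C G(1) finite_subset[of C "pverts G"]
    by (auto simp: pair_graph_iff)
  then have "Suc k \<le> card C"
    using f T(2) card_mono[of C "f ` pverts T"] by (simp add: graph_embedding_def card_image)
  with \<open>card C \<le> k\<close> show False by simp
qed

section \<open>The extremal graphs\<close>

abbreviation clique_union :: "nat \<Rightarrow> nat \<Rightarrow> nat pair_pre_digraph \<Rightarrow> (nat \<times> nat + nat) pair_pre_digraph" where
  "clique_union q k H \<equiv> disjoint_union (disjoint_copies q (complete_graph k)) H"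

lemma pair_graph_clique_union:
  assumes "pair_graph H"
  shows "pair_graph (clique_union q k H)"
  using assms
  by (auto simp: pair_graph_iff disjoint_union_def disjoint_copies_def complete_graph_def sym_def)

lemma card_clique_union:
  assumes "pair_graph H"
  shows "card (pverts (clique_union q k H)) = q * k + card (pverts H)"
proof -
  have "pverts (clique_union q k H) = Inl ` ({..<q} \<times> {..<k}) \<union> Inr ` pverts H"
    by (simp add: disjoint_union_def disjoint_copies_def complete_graph_def)
  then have "pverts (clique_union q k H) = ({..<q} \<times> {..<k}) <+> pverts H"
    by (simp add: Plus_def)
  moreover have "finite (pverts H)"
    using assms by (simp add: pair_graph_iff)
  ultimately show ?thesis
    by (simp add: card_Plus)
qed

text \<open>
  Each of the \<open>q\<close> copies of the complete graph is a component clique. As \<open>H\<close> has fewer than \<open>k\<close>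
  vertices, \<open>q\<close> equals the quotient \<open>card (pverts G) div k\<close>, which is the general upper bound.
\<close>

lemma component_cliques_clique_union:
  assumes H: "pair_graph H" "card (pverts H) < k"
    and G: "graph_iso (clique_union q k H) G"
  shows "card (component_cliques k G) = card (pverts G) div k"
proof (rule antisym)
  have pG: "pair_graph G" and cG: "card (pverts G) = q * k + card (pverts H)"
    using pair_graph_iso[OF pair_graph_clique_union[OF H(1)] G] card_clique_union[OF H(1)]
    by simp_all
  then show "card (component_cliques k G) \<le> card (pverts G) div k"
    using card_component_cliques_le[OF pG, of k] H(2) by simp
  let ?D = "clique_union q k H"
  obtain f where f: "inj_on f (pverts ?D)" and V: "pverts G = f ` pverts ?D"
    and A: "parcs G = map_prod f f ` parcs ?D"
    using G by (auto simp: graph_iso_iff)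
  have D: "pverts ?D = Inl ` ({..<q} \<times> {..<k}) \<union> Inr ` pverts H"
    by (simp add: disjoint_union_def disjoint_copies_def complete_graph_def)
  have arc: "(Inl (i, a), w) \<in> parcs ?D \<longleftrightarrow> (\<exists>b. w = Inl (i, b) \<and> i < q \<and> a < k \<and> b < k \<and> a \<noteq> b)"
    for i a w
    by (auto simp: disjoint_union_def disjoint_copies_def complete_graph_def)
  have Dw: "parcs ?D \<subseteq> pverts ?D \<times> pverts ?D"
    using pair_graph_clique_union[OF H(1)] by (simp add: pair_graph_iff)
  define X where "X i = (\<lambda>a. f (Inl (i, a))) ` {..<k}" for i
  have inj: "inj_on (\<lambda>a. f (Inl (i, a))) {..<k}" if "i < q" for i
    using f that by (auto simp: inj_on_def D)
  have "X i \<in> component_cliques k G" if i: "i < q" for i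
  proof -
    have "X i \<subseteq> pverts G"
      using i by (auto simp: X_def V D)
    moreover have "card (X i) = k"
      using inj[OF i] by (simp add: X_def card_image)
    moreover have "(u, v) \<in> parcs G" if uv: "u \<in> X i" "v \<in> X i" "u \<noteq> v" for u v
    proof -
      obtain a b where "u = f (Inl (i, a))" "v = f (Inl (i, b))" "a < k" "b < k"
        using uv by (auto simp: X_def)
      then have "(Inl (i, a), Inl (i, b)) \<in> parcs ?D" "(u, v) = map_prod f f (Inl (i, a), Inl (i, b))"
        using i uv arc by auto
      then show ?thesis unfolding A by (metis imageI)
    qed
    moreover have "v \<in> X i" if uv: "(u, v) \<in> parcs G" "u \<in> X i" for u v
    proof -
      obtain a where a: "u = f (Inl (i, a))" "a < k"
        using uv by (auto simp: X_def)
      obtain x y where xy: "(x, y) \<in> parcs ?D" "u = f x" "v = f y"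
        using uv A by auto
      have "x = Inl (i, a)"
        using f a xy Dw i by (auto simp: D dest!: inj_onD)
      then show ?thesis
        using xy arc by (auto simp: X_def)
    qed
    ultimately show ?thesis
      unfolding component_cliques_def cliques_def closed_under_arcs_def by blast
  qed
  then have "X ` {..<q} \<subseteq> component_cliques k G" by auto
  moreover have "inj_on X {..<q}"
  proof (rule inj_onI)
    fix i j assume ij: "i \<in> {..<q}" "j \<in> {..<q}" "X i = X j"
    \<comment> \<open>The sets \<open>X i\<close> are nonempty since \<open>k\<close> is positive, so a common point separates indices.\<close>
    have "f (Inl (i, 0)) \<in> X i"
      using H(2) by (auto simp: X_def)
    then obtain b where "b < k" "f (Inl (i, 0)) = f (Inl (j, b))"
      using ij by (auto simp: X_def)
    then have "Inl (i, 0) = (Inl (j, b) :: nat \<times> nat + nat)"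
      using f H(2) ij by (intro inj_onD[OF f]) (auto simp: D)
    then show "i = j" by simp
  qed
  ultimately have "q \<le> card (component_cliques k G)"
    using card_mono[OF finite_component_cliques[OF pG]] by (metis card_image card_lessThan)
  moreover have "card (pverts G) div k = q"
    using cG H(2) by (simp add: div_mult_self3 mult.commute)
  ultimately show "card (pverts G) div k \<le> card (component_cliques k G)"
    by simp
qed

text \<open>
  The isomorphism enumerates the component cliques by \<open>h\<close>, the vertices of each clique \<open>X\<close> by \<open>e X\<close>
  and the remaining vertices by \<open>g\<close>; \<open>H\<close> is the graph that \<open>g\<close> pulls back from the remainder.
\<close>

lemma clique_union_if_component_cliques:
  fixes G :: "'a pair_pre_digraph"
  assumes G: "pair_graph G" "card (component_cliques k G) = card (pverts G) div k"
  obtains H where "pair_graph H" "card (pverts H) = card (pverts G) mod k"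
    "graph_iso (clique_union (card (pverts G) div k) k H) G"
proof -
  define q r where "q = card (pverts G) div k" and "r = card (pverts G) mod k"
  define R where "R = pverts G - \<Union>(component_cliques k G)"
  have fin: "finite (pverts G)" and Gw: "parcs G \<subseteq> pverts G \<times> pverts G"
    and irr: "\<And>u. (u, u) \<notin> parcs G" and sy: "sym (parcs G)"
    using G by (auto simp: pair_graph_iff)
  have "finite R" "card R = r"
    using card_remainder[OF G] fin by (simp_all add: R_def r_def)
  then obtain g where g: "bij_betw g {..<r} R"
    by (metis bij_betw_from_nat_into_finite)
  obtain h where h: "bij_betw h {..<q} (component_cliques k G)"
    using finite_component_cliques[OF G(1)] G(2) unfolding q_def
    by (metis bij_betw_from_nat_into_finite)
  have "\<exists>e. bij_betw e {..<k} X" if "X \<in> component_cliques k G" for X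
    using that fin finite_subset[of X "pverts G"] bij_betw_from_nat_into_finite[of X]
    by (auto simp: component_cliques_def cliques_def)
  then obtain e where e: "\<And>X. X \<in> component_cliques k G \<Longrightarrow> bij_betw (e X) {..<k} X"
    by metis
  define H where "H = \<lparr>pverts = {..<r}, parcs = {(a, b). a < r \<and> b < r \<and> (g a, g b) \<in> parcs G}\<rparr>"
  have H: "pair_graph H" "card (pverts H) = r"
    using irr sy by (auto simp: H_def pair_graph_iff sym_def)
  let ?D = "clique_union q k H"
  define f where "f = case_sum (\<lambda>(i, a). e (h i) a) g"
  have hX: "h i \<in> component_cliques k G" if "i < q" for i
    using h that by (auto simp: bij_betw_def)
  have eX: "e (h i) a \<in> h i" if "i < q" "a < k" for i a
    using e[OF hX] that by (auto simp: bij_betw_def)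
  have gR: "g a \<in> R" if "a < r" for a
    using g that by (auto simp: bij_betw_def)
  have D: "pverts ?D = Inl ` ({..<q} \<times> {..<k}) \<union> Inr ` {..<r}"
    by (simp add: disjoint_union_def disjoint_copies_def complete_graph_def H_def)
  have inj: "inj_on f (pverts ?D)"
  proof (rule inj_onI)
    fix x y assume xy: "x \<in> pverts ?D" "y \<in> pverts ?D" "f x = f y"
    have 1: "i = j \<and> a = b" if "i < q" "j < q" "a < k" "b < k" "e (h i) a = e (h j) b" for i j a b
    proof -
      have "h i = h j"
        using component_cliques_disjoint[OF hX hX] eX that by (metis disjoint_iff)
      then have "i = j"
        using h that by (auto simp: bij_betw_def dest: inj_onD)
      then show ?thesis
        using e[OF hX] that by (auto simp: bij_betw_def dest: inj_onD)
    qed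
    have 2: "e (h i) a \<noteq> g b" if "i < q" "a < k" "b < r" for i a b
      using eX[of i a] hX[of i] gR[of b] that by (auto simp: R_def)
    have 3: "a = b" if "a < r" "b < r" "g a = g b" for a b
      using g that by (auto simp: bij_betw_def dest: inj_onD)
    show "x = y"
      using xy 1 2 3 2[symmetric] by (auto simp: D f_def)
  qed
  have V: "f ` pverts ?D = pverts G"
  proof -
    have "f ` pverts ?D = (\<Union>i<q. e (h i) ` {..<k}) \<union> g ` {..<r}"
      unfolding D f_def image_Un image_image by (auto simp: image_image)
    also have "\<dots> = (\<Union>i<q. h i) \<union> R"
      using e[OF hX] g by (simp add: bij_betw_def)
    also have "\<dots> = \<Union>(component_cliques k G) \<union> R"
      using h by (simp add: bij_betw_def)
    finally show ?thesis
      using Union_component_cliques_subset[of k G] by (auto simp: R_def)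
  qed
  have arc: "(x, y) \<in> parcs ?D \<longleftrightarrow> (f x, f y) \<in> parcs G" if xy: "x \<in> pverts ?D" "y \<in> pverts ?D" for x y
  proof -
    have cl: "v \<in> h i" if "(u, v) \<in> parcs G" "u \<in> h i" "i < q" for u v i
      using that hX by (auto simp: component_cliques_def closed_under_arcs_def)
    have 0: "i = j" if "u \<in> h i" "u \<in> h j" "i < q" "j < q" for u i j
      using that component_cliques_disjoint[OF hX hX, of i j] h
      by (auto simp: bij_betw_def dest: inj_onD)
    have 1: "(e (h i) a, e (h j) b) \<in> parcs G \<longleftrightarrow> i = j \<and> a \<noteq> b"
      if "i < q" "j < q" "a < k" "b < k" for i j a b
    proof
      assume *: "(e (h i) a, e (h j) b) \<in> parcs G"
      then have "i = j" using cl eX that 0 by metis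
      then show "i = j \<and> a \<noteq> b" using * irr by auto
    next
      assume *: "i = j \<and> a \<noteq> b"
      then have "e (h i) a \<noteq> e (h j) b"
        using e[OF hX[of i]] that by (auto simp: bij_betw_def dest: inj_onD)
      then show "(e (h i) a, e (h j) b) \<in> parcs G"
        using * eX that hX[of i] by (auto simp: component_cliques_def cliques_def)
    qed
    \<comment> \<open>There is no arc between a component clique and the remainder, in either direction.\<close>
    have 2: "(e (h i) a, g b) \<notin> parcs G" if "i < q" "a < k" "b < r" for i a b
      using cl eX gR hX that by (fastforce simp: R_def)
    then have 3: "(g b, e (h i) a) \<notin> parcs G" if "i < q" "a < k" "b < r" for i a b
      using that sy by (meson symD)
    show ?thesis
      using xy 1 2 3 unfolding D
      by (auto simp: f_def disjoint_union_def disjoint_copies_def complete_graph_def H_def)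
  qed
  have Dw: "pair_graph ?D"
    using pair_graph_clique_union H by blast
  have "parcs G = map_prod f f ` parcs ?D"
  proof (intro equalityI subsetI)
    fix z assume z: "z \<in> parcs G"
    then have "z \<in> f ` pverts ?D \<times> f ` pverts ?D"
      using Gw unfolding V by blast
    then obtain x y where "z = (f x, f y)" "x \<in> pverts ?D" "y \<in> pverts ?D"
      by blast
    then show "z \<in> map_prod f f ` parcs ?D"
      using z arc[of x y] by (metis map_prod_imageI)
  next
    fix z assume "z \<in> map_prod f f ` parcs ?D"
    then obtain x y where "z = (f x, f y)" "(x, y) \<in> parcs ?D"
      by auto
    moreover from this have "x \<in> pverts ?D" "y \<in> pverts ?D"
      using Dw by (auto simp only: pair_graph_iff)
    ultimately show "z \<in> parcs G"
      using arc by blast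
  qed
  then have "graph_iso ?D G"
    using Dw inj V[symmetric] unfolding graph_iso_iff by (blast intro: pair_graph_wf)
  then show thesis
    using that H q_def r_def by blast
qed

text \<open>
  The maximum is attained by the disjoint union of \<open>n div k\<close> complete graphs and isolated vertices.
\<close>

lemma ex_clique_tree:
  assumes T: "undirected_tree T" "card (pverts T) = Suc k" "0 < k"
  shows "ex n (complete_graph k) T = n div k"
  unfolding ex_def
proof (rule Max_eqI)
  let ?S = "{card (copies (complete_graph k) G) | G :: nat pair_pre_digraph.
     pair_graph G \<and> card (pverts G) = n \<and> free_of T G}"
  show le: "y \<le> n div k" if "y \<in> ?S" for y
    using that tree_free_cliques_closed[OF T] card_component_cliques_le[OF _ T(3)]
    by (force simp: card_copies_complete_graph)
  then show "finite ?S"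
    by (meson finite_nat_set_iff_bounded_le)
  define H :: "nat pair_pre_digraph" where "H = \<lparr>pverts = {..<n mod k}, parcs = {}\<rparr>"
  have H: "pair_graph H" "card (pverts H) = n mod k"
    by (auto simp: H_def pair_graph_iff sym_def)
  let ?D = "clique_union (n div k) k H"
  \<comment> \<open>The maximum ranges over graphs with natural numbers as vertices, so the union is encoded.\<close>
  define G :: "nat pair_pre_digraph" where
    "G = \<lparr>pverts = to_nat ` pverts ?D, parcs = map_prod to_nat to_nat ` parcs ?D\<rparr>"
  have iso: "graph_iso ?D G"
    using pair_graph_clique_union[OF H(1)] unfolding graph_iso_iff G_def
    by (auto intro!: exI[of _ to_nat] simp: pair_graph_wf)
  have G: "pair_graph G" "card (pverts G) = n"
    using pair_graph_iso[OF pair_graph_clique_union[OF H(1)] iso] card_clique_union[OF H(1)] H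
    by simp_all
  have c: "card (component_cliques k G) = card (pverts G) div k"
    using component_cliques_clique_union[OF H(1) _ iso] H T(3) by simp
  then have "free_of T G"
    using tree_free_if_component_cliques[OF T] G by blast
  moreover from this have "n div k = card (copies (complete_graph k) G)"
    using tree_free_cliques_closed[OF T G(1)] card_copies_complete_graph[OF G(1)] c G(2) by simp
  ultimately show "n div k \<in> ?S"
    using G by blast
qed

theorem theorem1p3:
  fixes t n :: nat and T :: "'b pair_pre_digraph"
  assumes "t \<ge> 2"
    and "undirected_tree T" and "card (pverts T) = t"
    and "n \<ge> 1"
  shows "ex n (complete_graph (t - 1)) T = n div (t - 1) \<and>
    (\<forall>G :: 'a pair_pre_digraph.
       extremal n (complete_graph (t - 1)) T G \<longleftrightarrow>
       (\<exists>H :: nat pair_pre_digraph. pair_graph H \<and> card (pverts H) = n mod (t - 1) \<and>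
          graph_iso G (disjoint_union (disjoint_copies (n div (t - 1)) (complete_graph (t - 1))) H)))"
proof (intro conjI allI)
  define k where "k = t - 1"
  have T: "undirected_tree T" "card (pverts T) = Suc k" "0 < k"
    using assms by (auto simp: k_def)
  show ex: "ex n (complete_graph (t - 1)) T = n div (t - 1)"
    using ex_clique_tree[OF T] by (simp add: k_def)
  fix G :: "'a pair_pre_digraph"
  have "extremal n (complete_graph k) T G \<longleftrightarrow>
      pair_graph G \<and> card (pverts G) = n \<and> card (component_cliques k G) = n div k"
  proof
    assume "extremal n (complete_graph k) T G"
    then have G: "pair_graph G" "card (pverts G) = n" "free_of T G"
      and copies: "card (copies (complete_graph k) G) = n div k"
      unfolding extremal_def ex_clique_tree[OF T] by simp_all
    with copies show "pair_graph G \<and> card (pverts G) = n \<and> card (component_cliques k G) = n div k"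
      using tree_free_cliques_closed[OF T G(1,3)] card_copies_complete_graph[OF G(1)] by simp
  next
    assume "pair_graph G \<and> card (pverts G) = n \<and> card (component_cliques k G) = n div k"
    then have G: "pair_graph G" "card (pverts G) = n" and c: "card (component_cliques k G) = n div k"
      by simp_all
    have free: "free_of T G"
      using tree_free_if_component_cliques[OF T G(1)] G(2) c by simp
    show "extremal n (complete_graph k) T G"
      unfolding extremal_def ex_clique_tree[OF T]
      using G c free tree_free_cliques_closed[OF T G(1) free] card_copies_complete_graph[OF G(1)]
      by simp
  qed
  also have "\<dots> \<longleftrightarrow> (\<exists>H. pair_graph H \<and> card (pverts H) = n mod k \<and>
      graph_iso G (clique_union (n div k) k H))"
  proof
    assume "pair_graph G \<and> card (pverts G) = n \<and> card (component_cliques k G) = n div k"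
    then show "\<exists>H. pair_graph H \<and> card (pverts H) = n mod k \<and>
        graph_iso G (clique_union (n div k) k H)"
      using clique_union_if_component_cliques[of G k] graph_iso_sym by metis
  next
    assume "\<exists>H. pair_graph H \<and> card (pverts H) = n mod k \<and>
        graph_iso G (clique_union (n div k) k H)"
    then obtain H where H: "pair_graph H" "card (pverts H) = n mod k"
      and iso: "graph_iso G (clique_union (n div k) k H)"
      by blast
    have iso': "graph_iso (clique_union (n div k) k H) G"
      using graph_iso_sym[OF iso] .
    have "pair_graph G" "card (pverts G) = n"
      using pair_graph_iso[OF pair_graph_clique_union[OF H(1)] iso'] card_clique_union[OF H(1)] H
      by simp_all
    then show "pair_graph G \<and> card (pverts G) = n \<and> card (component_cliques k G) = n div k"
      using component_cliques_clique_union[OF H(1) _ iso'] H T(3) by simp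
  qed
  finally show "extremal n (complete_graph (t - 1)) T G \<longleftrightarrow>
       (\<exists>H :: nat pair_pre_digraph. pair_graph H \<and> card (pverts H) = n mod (t - 1) \<and>
          graph_iso G (disjoint_union (disjoint_copies (n div (t - 1)) (complete_graph (t - 1))) H))"
    by (simp add: k_def)
qed

end
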